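(* Let $1\le t\le n$ be integers and let $f:\{0,1\}^n\to\{0,1\}$ be a Boolean function that is either constant or balanced. For $w'\in\{0,1\}^{t-1}$ define $f_{w'0},f_{w'1}:\{0,1\}^{n-t}\to\{0,1\}$ by $f_{w'0}(u)=f(uw'0)$ and $f_{w'1}(u)=f(uw'1)$. For $u\in\{0,1\}^{n-t}$ let $$\Delta(u)=|\{w'\in\{0,1\}^{t-1}: f_{w'0}(u)=0,\ f_{w'1}(u)=0\}|-|\{w'\in\{0,1\}^{t-1}: f_{w'0}(u)=1,\ f_{w'1}(u)=1\}|.$$ Then: (1) $f$ is constant if and only if either $\Delta(u)=2^{t-1}$ for all $u\in\{0,1\}^{n-t}$, or $\Delta(u)=-2^{t-1}$ for all $u\in\{0,1\}^{n-t}$; (2) $f$ is balanced if and only if $\sum_{u\in\{0,1\}^{n-t}}\Delta(u)=0$.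
   Context: A Boolean function $f:\{0,1\}^n\to\{0,1\}$ is constant if $f\equiv 0$ or $f\equiv 1$, and balanced if $|\{x: f(x)=0\}|=|\{x: f(x)=1\}|=2^{n-1}$. Juxtaposition of bit strings (e.g. $uw'0$) denotes concatenation; $\{0,1\}^0$ consists of the empty string. *)

theory Defs imports Main begin

text \<open>
  The bits 0 and 1 are \<^term>\<open>False\<close> and \<^term>\<open>True\<close>; bit strings are lists, concatenation is
  \<^term>\<open>(@)\<close>. A Boolean function on strings of length \<open>n\<close> is a function on all lists of which
  only the values on \<open>bitstrings n\<close> are ever used.
\<close>

definition bitstrings :: "nat \<Rightarrow> bool list set" where
  "bitstrings n = {x. length x = n}"

definition is_constant :: "nat \<Rightarrow> (bool list \<Rightarrow> bool) \<Rightarrow> bool" where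
  "is_constant n f \<longleftrightarrow>
     (\<forall>x \<in> bitstrings n. f x = False) \<or> (\<forall>x \<in> bitstrings n. f x = True)"

definition is_balanced :: "nat \<Rightarrow> (bool list \<Rightarrow> bool) \<Rightarrow> bool" where
  "is_balanced n f \<longleftrightarrow>
     card {x \<in> bitstrings n. f x = False} = 2 ^ (n - 1) \<and>
     card {x \<in> bitstrings n. f x = True} = 2 ^ (n - 1)"

definition subfunction :: "(bool list \<Rightarrow> bool) \<Rightarrow> bool list \<Rightarrow> bool list \<Rightarrow> bool" where
  "subfunction f w u = f (u @ w)"

definition Delta :: "nat \<Rightarrow> (bool list \<Rightarrow> bool) \<Rightarrow> bool list \<Rightarrow> int" where
  "Delta t f u =
     int (card {w' \<in> bitstrings (t - 1).
       subfunction f (w' @ [False]) u = False \<and> subfunction f (w' @ [True]) u = False}) -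
     int (card {w' \<in> bitstrings (t - 1).
       subfunction f (w' @ [False]) u = True \<and> subfunction f (w' @ [True]) u = True})"

end

theory Submission imports Defs begin

text \<open>
  Replacing the bit \<open>b\<close> by the sign \<open>(-1)\<^sup>b\<close> makes \<open>2 * Delta t f u\<close> the sum of the signs of
  \<open>f\<close> over all strings with prefix \<open>u\<close>. Hence the sum of \<open>Delta\<close> over all prefixes is half
  the difference between the number of zeros and the number of ones of \<open>f\<close>.
\<close>

definition bit_sign :: "bool \<Rightarrow> int" where
  "bit_sign b = (if b then - 1 else 1)"

lemma bitstrings_eq_lists: "bitstrings n = {xs. set xs \<subseteq> UNIV \<and> length xs = n}"
  by (simp add: bitstrings_def)

lemma finite_bitstrings [simp]: "finite (bitstrings n)"
  unfolding bitstrings_eq_lists by (rule finite_lists_length_eq) simp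

lemma card_bitstrings [simp]: "card (bitstrings n) = 2 ^ n"
  unfolding bitstrings_eq_lists by (subst card_lists_length_eq) simp_all

text \<open>Cutting a string after its first \<open>m\<close> bits is a bijection onto pairs of
  shorter strings, with concatenation as inverse.\<close>

lemma sum_bitstrings_add:
  "sum g (bitstrings (m + k)) = (\<Sum>u \<in> bitstrings m. \<Sum>v \<in> bitstrings k. g (u @ v))"
proof -
  have "(\<Sum>u \<in> bitstrings m. \<Sum>v \<in> bitstrings k. g (u @ v)) =
      (\<Sum>(u, v) \<in> bitstrings m \<times> bitstrings k. g (u @ v))"
    by (simp add: sum.cartesian_product)
  also have "\<dots> = sum g (bitstrings (m + k))"
    by (rule sum.reindex_bij_witness[where i = "\<lambda>x. (take m x, drop m x)"
          and j = "\<lambda>(u, v). u @ v"]) (auto simp: bitstrings_def)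
  finally show ?thesis ..
qed

lemma sum_bitstrings_Suc:
  "sum g (bitstrings (Suc k)) = (\<Sum>w \<in> bitstrings k. g (w @ [False]) + g (w @ [True]))"
proof -
  have "bitstrings 1 = {[False], [True]}"
    by (auto simp: bitstrings_def length_Suc_conv)
  then show ?thesis
    using sum_bitstrings_add[of g k 1] by simp
qed

text \<open>Group the strings of length \<open>t\<close> by all but their last bit. If the two
  values of \<open>f\<close> in a group agree, their signs add up to 2 or -2; if they differ, the
  signs cancel, just as \<open>Delta\<close> ignores such a group. The factor 2 avoids division in
  the integers.\<close>

lemma double_Delta:
  assumes "1 \<le> t"
  shows "2 * Delta t f u = (\<Sum>w \<in> bitstrings t. bit_sign (f (u @ w)))"
proof -
  \<comment> \<open>With cardinalities written as sums of indicators, the identity can be checked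
    for each string separately.\<close>
  have card_eq: "int (card {w \<in> bitstrings k. P w}) = (\<Sum>w \<in> bitstrings k. of_bool (P w))"
    for k P by (simp add: of_bool_def sum.If_cases Collect_conj_eq)
  have "2 * Delta t f u =
      (\<Sum>w \<in> bitstrings (t - 1). bit_sign (f (u @ w @ [False])) + bit_sign (f (u @ w @ [True])))"
    unfolding Delta_def card_eq sum_subtractf[symmetric] sum_distrib_left
    by (rule sum.cong) (auto simp: bit_sign_def subfunction_def)
  also have "\<dots> = (\<Sum>w \<in> bitstrings (Suc (t - 1)). bit_sign (f (u @ w)))"
    by (simp add: sum_bitstrings_Suc)
  finally show ?thesis
    using assms by simp
qed

lemma double_sum_Delta:
  assumes "1 \<le> t" and "t \<le> n"
  shows "2 * (\<Sum>u \<in> bitstrings (n - t). Delta t f u) = (\<Sum>x \<in> bitstrings n. bit_sign (f x))"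
  using assms sum_bitstrings_add[of "\<lambda>x. bit_sign (f x)" "n - t" t]
  by (simp add: sum_distrib_left double_Delta)

text \<open>The sign sum is the number of zeros minus the number of ones. Both numbers together make
  \<open>2 ^ n\<close>, so they are equal exactly when each is half of that.\<close>

lemma is_balanced_iff_sum_bit_sign:
  assumes "1 \<le> n"
  shows "is_balanced n f \<longleftrightarrow> (\<Sum>x \<in> bitstrings n. bit_sign (f x)) = 0"
proof -
  define a b where "a = card {x \<in> bitstrings n. \<not> f x}" and "b = card {x \<in> bitstrings n. f x}"
  have "a + b = card ({x \<in> bitstrings n. \<not> f x} \<union> {x \<in> bitstrings n. f x})"
    unfolding a_def b_def by (rule card_Un_disjoint[symmetric]) auto
  also have "{x \<in> bitstrings n. \<not> f x} \<union> {x \<in> bitstrings n. f x} = bitstrings n"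
    by auto
  finally have "a + b = 2 * 2 ^ (n - 1)"
    using assms by (simp flip: power_Suc)
  moreover have "(\<Sum>x \<in> bitstrings n. bit_sign (f x)) = int a - int b"
    by (simp add: bit_sign_def sum.If_cases a_def b_def Collect_conj_eq Collect_neg_eq)
  ultimately show ?thesis
    unfolding is_balanced_def by (auto simp flip: a_def b_def)
qed

text \<open>All \<open>2 ^ t\<close> signs in \<open>double_Delta\<close> coincide; halving leaves
  \<open>2 ^ (t - 1)\<close> of them.\<close>

lemma Delta_eq_of_constant:
  assumes "1 \<le> t" and "t \<le> n" and "\<forall>x \<in> bitstrings n. f x = c" and "u \<in> bitstrings (n - t)"
  shows "Delta t f u = bit_sign c * 2 ^ (t - 1)"
proof -
  have "f (u @ w) = c" if "w \<in> bitstrings t" for w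
    using that assms by (simp add: bitstrings_def)
  then have "2 * Delta t f u = 2 * (bit_sign c * 2 ^ (t - 1))"
    using assms(1) by (simp add: double_Delta flip: power_Suc)
  then show ?thesis by simp
qed

theorem theorem3:
  fixes n t :: nat and f :: "bool list \<Rightarrow> bool"
  assumes "1 \<le> t" and "t \<le> n"
    and "is_constant n f \<or> is_balanced n f"
  shows "(is_constant n f \<longleftrightarrow>
            (\<forall>u \<in> bitstrings (n - t). Delta t f u = 2 ^ (t - 1)) \<or>
            (\<forall>u \<in> bitstrings (n - t). Delta t f u = - (2 ^ (t - 1)))) \<and>
         (is_balanced n f \<longleftrightarrow> (\<Sum>u \<in> bitstrings (n - t). Delta t f u) = 0)"
    (is "(_ \<longleftrightarrow> ?pos \<or> ?neg) \<and> _")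
proof -
  have balanced: "is_balanced n f \<longleftrightarrow> (\<Sum>u \<in> bitstrings (n - t). Delta t f u) = 0"
    using assms is_balanced_iff_sum_bit_sign[of n f] double_sum_Delta[of t n f] by auto
  have "?pos \<or> ?neg" if "is_constant n f"
  proof -
    from \<open>is_constant n f\<close> obtain c where "\<forall>x \<in> bitstrings n. f x = c"
      unfolding is_constant_def by (elim disjE) (rule that, assumption)+
    then have "\<forall>u \<in> bitstrings (n - t). Delta t f u = bit_sign c * 2 ^ (t - 1)"
      using Delta_eq_of_constant[OF assms(1,2)] by blast
    then show ?thesis
      by (cases c) (simp_all add: bit_sign_def)
  qed
  moreover have "is_constant n f" if "?pos \<or> ?neg"
  proof -
    \<comment> \<open>A sum of \<open>2 ^ (n - t)\<close> equal nonzero terms cannot vanish, so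
      \<open>f\<close> is not balanced, and the assumed dichotomy leaves only the constant
      case.\<close>
    from that have "(\<Sum>u \<in> bitstrings (n - t). Delta t f u) \<noteq> 0"
      by auto
    then show ?thesis
      using balanced assms(3) by simp
  qed
  ultimately show ?thesis
    using balanced by blast
qed

end
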